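(* Consider the following equations in the unary symbol $\neg$, the binary symbols $\wedge,\vee$ and (where they occur) the constants $\mathsf T,\mathsf F,\mathsf U$: (Neg) $\mathsf F=\neg\mathsf T$; (Or) $x\vee y=\neg(\neg x\wedge\neg y)$; (Tand) $\mathsf T\wedge x=x$; (Abs) $x\wedge(x\vee y)=x$; (Mem) $(x\vee y)\wedge z=(\neg x\wedge(y\wedge z))\vee(x\wedge z)$; (Com) $(x\wedge y)\vee(y\wedge x)=(y\wedge x)\vee(x\wedge y)$; (Und) $\neg\mathsf U=\mathsf U$. Then: (i) $\mathrm{CL}$ (no constants distinguished) is completely axiomatised by the five axioms $\neg\neg x=x$, (Or), (Abs), (Mem), (Com), and these axioms are independent. (ii) $\mathrm{CL}_2$ ($\mathsf T$ and $\mathsf F$ distinguished) is completely axiomatised by the six axioms (Neg), (Or), (Tand), (Abs), (Mem), (Com), and these axioms are independent. (iii) $\mathrm{CL}^{\mathsf U}$ (only $\mathsf U$ distinguished) is completely axiomatised by the six axioms $\neg\neg x=x$, $\neg\mathsf U=\mathsf U$, (Or), (Abs), (Mem), (Com), and these axioms are independent. (iv) $\mathrm{CL}_3$ (all constants distinguished) is completely axiomatised by the seven axioms (Neg), (Or), (Tand), (Abs), (Mem), (Com), (Und), and these axioms are independent.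
   Context: $\mathrm{CL}$ (conditional logic of Guzmán and Squier) is the equational theory over the signature $\{\neg,\wedge,\vee\}$ axiomatised by $\neg\neg x=x$; $\neg(x\wedge y)=\neg x\vee\neg y$; $(x\wedge y)\wedge z=x\wedge(y\wedge z)$; $x\wedge(y\vee z)=(x\wedge y)\vee(x\wedge z)$; $(x\vee y)\wedge z=(x\wedge z)\vee(\neg x\wedge y\wedge z)$ (bracketing immaterial by associativity); $x\vee(x\wedge y)=x$; $(x\wedge y)\vee(y\wedge x)=(y\wedge x)\vee(x\wedge y)$. $\mathrm{CL}_2$ is $\mathrm{CL}$ with constants $\mathsf T,\mathsf F$ and the extra axioms $\mathsf T\wedge x=x$, $\neg\mathsf T=\mathsf F$. $\mathrm{CL}^{\mathsf U}$ is $\mathrm{CL}$ with constant $\mathsf U$ and the extra axiom $\neg\mathsf U=\mathsf U$. $\mathrm{CL}_3$ is $\mathrm{CL}$ with constants $\mathsf T,\mathsf F,\mathsf U$ and the three extra axioms $\mathsf T\wedge x=x$, $\neg\mathsf T=\mathsf F$, $\neg\mathsf U=\mathsf U$. A set $E$ of equations completely axiomatises one of these logics if, over the corresponding signature, exactly the equations of that logic (i.e. the equational consequences of its axioms just listed) are derivable from $E$ in equational logic. (By a theorem of Guzmán and Squier these are exactly the equations valid in the algebra $C=\{\mathsf T,\mathsf F,\mathsf U\}$ with $\neg\mathsf T=\mathsf F$, $\neg\mathsf F=\mathsf T$, $\neg\mathsf U=\mathsf U$; $\mathsf T\wedge y=y$, $\mathsf F\wedge y=\mathsf F$, $\mathsf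 U\wedge y=\mathsf U$; $\mathsf T\vee y=\mathsf T$, $\mathsf F\vee y=y$, $\mathsf U\vee y=\mathsf U$, with the relevant constants distinguished.) A group of axioms is independent if no axiom in it is derivable (in equational logic) from the other axioms of the group. *)

theory Defs
  imports Main
begin

datatype cst = CT | CF | CU

datatype trm =
    Var nat
  | Cst cst
  | Neg trm (\<open>\<^bold>\<not> _\<close> [80] 80)
  | Conj trm trm (infixr \<open>\<^bold>\<and>\<close> 70)
  | Disj trm trm (infixr \<open>\<^bold>\<or>\<close> 65)

abbreviation trm_T (\<open>\<^bold>T\<close>) where "\<^bold>T \<equiv> Cst CT"
abbreviation trm_F (\<open>\<^bold>F\<close>) where "\<^bold>F \<equiv> Cst CF"
abbreviation trm_U (\<open>\<^bold>U\<close>) where "\<^bold>U \<equiv> Cst CU"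

abbreviation var_x (\<open>\<^bold>x\<close>) where "\<^bold>x \<equiv> Var 0"
abbreviation var_y (\<open>\<^bold>y\<close>) where "\<^bold>y \<equiv> Var 1"
abbreviation var_z (\<open>\<^bold>z\<close>) where "\<^bold>z \<equiv> Var 2"

type_synonym eqn = "trm \<times> trm"

abbreviation mk_eqn :: "trm \<Rightarrow> trm \<Rightarrow> eqn" (infix \<open>\<^bold>=\<close> 50)
  where "s \<^bold>= t \<equiv> (s, t)"

primrec csts :: "trm \<Rightarrow> cst set" where
  "csts (Var n) = {}"
| "csts (Cst c) = {c}"
| "csts (\<^bold>\<not> t) = csts t"
| "csts (s \<^bold>\<and> t) = csts s \<union> csts t"
| "csts (s \<^bold>\<or> t) = csts s \<union> csts t"

text \<open>All signatures contain negation, conjunction and disjunction; a signature is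
  therefore given by its set of constants.\<close>

definition terms :: "cst set \<Rightarrow> trm set" where
  "terms C = {t. csts t \<subseteq> C}"

definition equations :: "cst set \<Rightarrow> eqn set" where
  "equations C = terms C \<times> terms C"

primrec subst :: "(nat \<Rightarrow> trm) \<Rightarrow> trm \<Rightarrow> trm" where
  "subst \<sigma> (Var n) = \<sigma> n"
| "subst \<sigma> (Cst c) = Cst c"
| "subst \<sigma> (\<^bold>\<not> t) = \<^bold>\<not> (subst \<sigma> t)"
| "subst \<sigma> (s \<^bold>\<and> t) = subst \<sigma> s \<^bold>\<and> subst \<sigma> t"
| "subst \<sigma> (s \<^bold>\<or> t) = subst \<sigma> s \<^bold>\<or> subst \<sigma> t"

text \<open>Equational logic over the signature with constants \<open>C\<close>: every term occurring in a
  derivation belongs to that signature, also the substituted ones.\<close>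

inductive derivable :: "cst set \<Rightarrow> eqn set \<Rightarrow> eqn \<Rightarrow> bool"
  for C :: "cst set" and E :: "eqn set" where
  ax: "e \<in> E \<Longrightarrow> e \<in> equations C \<Longrightarrow> derivable C E e"
| refl: "t \<in> terms C \<Longrightarrow> derivable C E (t \<^bold>= t)"
| sym: "derivable C E (s \<^bold>= t) \<Longrightarrow> derivable C E (t \<^bold>= s)"
| trans: "derivable C E (s \<^bold>= t) \<Longrightarrow> derivable C E (t \<^bold>= u) \<Longrightarrow> derivable C E (s \<^bold>= u)"
| inst: "derivable C E (s \<^bold>= t) \<Longrightarrow> (\<And>n. \<sigma> n \<in> terms C) \<Longrightarrow>
    derivable C E (subst \<sigma> s \<^bold>= subst \<sigma> t)"
| cong_Neg: "derivable C E (s \<^bold>= t) \<Longrightarrow> derivable C E (\<^bold>\<not> s \<^bold>= \<^bold>\<not> t)"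
| cong_Conj: "derivable C E (s \<^bold>= t) \<Longrightarrow> derivable C E (s' \<^bold>= t') \<Longrightarrow>
    derivable C E (s \<^bold>\<and> s' \<^bold>= t \<^bold>\<and> t')"
| cong_Disj: "derivable C E (s \<^bold>= t) \<Longrightarrow> derivable C E (s' \<^bold>= t') \<Longrightarrow>
    derivable C E (s \<^bold>\<or> s' \<^bold>= t \<^bold>\<or> t')"

text \<open>\<open>L\<close> is the defining set of axioms of the logic that is axiomatised by \<open>E\<close>.\<close>

definition completely_axiomatises :: "cst set \<Rightarrow> eqn set \<Rightarrow> eqn set \<Rightarrow> bool" where
  "completely_axiomatises C E L \<longleftrightarrow>
     E \<subseteq> equations C \<and> (\<forall>e \<in> equations C. derivable C E e \<longleftrightarrow> derivable C L e)"

definition independent :: "cst set \<Rightarrow> eqn set \<Rightarrow> bool" where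
  "independent C E \<longleftrightarrow> (\<forall>e \<in> E. \<not> derivable C (E - {e}) e)"

definition CL :: "eqn set" where
  "CL = {
     \<^bold>\<not> \<^bold>\<not> \<^bold>x \<^bold>= \<^bold>x,
     \<^bold>\<not> (\<^bold>x \<^bold>\<and> \<^bold>y) \<^bold>= \<^bold>\<not> \<^bold>x \<^bold>\<or> \<^bold>\<not> \<^bold>y,
     (\<^bold>x \<^bold>\<and> \<^bold>y) \<^bold>\<and> \<^bold>z \<^bold>= \<^bold>x \<^bold>\<and> (\<^bold>y \<^bold>\<and> \<^bold>z),
     \<^bold>x \<^bold>\<and> (\<^bold>y \<^bold>\<or> \<^bold>z) \<^bold>= (\<^bold>x \<^bold>\<and> \<^bold>y) \<^bold>\<or> (\<^bold>x \<^bold>\<and> \<^bold>z),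
     (\<^bold>x \<^bold>\<or> \<^bold>y) \<^bold>\<and> \<^bold>z \<^bold>= (\<^bold>x \<^bold>\<and> \<^bold>z) \<^bold>\<or> (\<^bold>\<not> \<^bold>x \<^bold>\<and> (\<^bold>y \<^bold>\<and> \<^bold>z)),
     \<^bold>x \<^bold>\<or> (\<^bold>x \<^bold>\<and> \<^bold>y) \<^bold>= \<^bold>x,
     (\<^bold>x \<^bold>\<and> \<^bold>y) \<^bold>\<or> (\<^bold>y \<^bold>\<and> \<^bold>x) \<^bold>= (\<^bold>y \<^bold>\<and> \<^bold>x) \<^bold>\<or> (\<^bold>x \<^bold>\<and> \<^bold>y)}"

definition CL2 :: "eqn set" where
  "CL2 = CL \<union> {\<^bold>T \<^bold>\<and> \<^bold>x \<^bold>= \<^bold>x, \<^bold>\<not> \<^bold>T \<^bold>= \<^bold>F}"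

definition CLU :: "eqn set" where
  "CLU = CL \<union> {\<^bold>\<not> \<^bold>U \<^bold>= \<^bold>U}"

definition CL3 :: "eqn set" where
  "CL3 = CL \<union> {\<^bold>T \<^bold>\<and> \<^bold>x \<^bold>= \<^bold>x, \<^bold>\<not> \<^bold>T \<^bold>= \<^bold>F, \<^bold>\<not> \<^bold>U \<^bold>= \<^bold>U}"

definition DNeg_eq :: eqn where
  "DNeg_eq = (\<^bold>\<not> \<^bold>\<not> \<^bold>x \<^bold>= \<^bold>x)"

definition Neg_eq :: eqn where
  "Neg_eq = (\<^bold>F \<^bold>= \<^bold>\<not> \<^bold>T)"

definition Or_eq :: eqn where
  "Or_eq = (\<^bold>x \<^bold>\<or> \<^bold>y \<^bold>= \<^bold>\<not> (\<^bold>\<not> \<^bold>x \<^bold>\<and> \<^bold>\<not> \<^bold>y))"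

definition Tand_eq :: eqn where
  "Tand_eq = (\<^bold>T \<^bold>\<and> \<^bold>x \<^bold>= \<^bold>x)"

definition Abs_eq :: eqn where
  "Abs_eq = (\<^bold>x \<^bold>\<and> (\<^bold>x \<^bold>\<or> \<^bold>y) \<^bold>= \<^bold>x)"

definition Mem_eq :: eqn where
  "Mem_eq = ((\<^bold>x \<^bold>\<or> \<^bold>y) \<^bold>\<and> \<^bold>z \<^bold>= (\<^bold>\<not> \<^bold>x \<^bold>\<and> (\<^bold>y \<^bold>\<and> \<^bold>z)) \<^bold>\<or> (\<^bold>x \<^bold>\<and> \<^bold>z))"

definition Com_eq :: eqn where
  "Com_eq = ((\<^bold>x \<^bold>\<and> \<^bold>y) \<^bold>\<or> (\<^bold>y \<^bold>\<and> \<^bold>x) \<^bold>= (\<^bold>y \<^bold>\<and> \<^bold>x) \<^bold>\<or> (\<^bold>x \<^bold>\<and> \<^bold>y))"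

definition Und_eq :: eqn where
  "Und_eq = (\<^bold>\<not> \<^bold>U \<^bold>= \<^bold>U)"

end

(* Equational logic is complete: for a set E of equations with a nontrivial model, the quotient of
   the terms by derivability is countably infinite, so it can be realised on the natural numbers.
   Hence two axiom systems are equivalent as soon as every algebra satisfying one satisfies the
   other, and an axiom is independent as soon as some algebra satisfies all the others but not it.

   (Mem) differs from the distribution axiom of CL in the order of the disjuncts of its right-hand
   side. Write s = x & y and t = ~x & z. From either axiom system, (x | z) & (~x | y) and
   (~x | y) & (x | z) are s | t and t | s, in one order or the other, so (Com) yields
   (s | t) | (t | s) = (t | s) | (s | t). Since u | v | u = u | v, this says s | t = t | s, which
   turns (Mem) into the distribution axiom and conversely.

   The independence models are mostly variations of the three-valued algebra C: other values for
   the constants, the strong Kleene conjunction, or two undefined values instead of one. *)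
theory Submission
  imports Defs "HOL-Library.Countable_Set"
begin

section \<open>From (Mem) to the axioms of conditional logic\<close>

locale memorising_algebra =
  fixes neg :: "'a \<Rightarrow> 'a"  (\<open>\<sim> _\<close> [80] 80)
    and conj :: "'a \<Rightarrow> 'a \<Rightarrow> 'a"  (infixr \<open>\<sqinter>\<close> 70)
    and disj :: "'a \<Rightarrow> 'a \<Rightarrow> 'a"  (infixr \<open>\<squnion>\<close> 65)
  assumes dneg: "\<sim> \<sim> x = x"
    and disj_eq: "x \<squnion> y = \<sim> (\<sim> x \<sqinter> \<sim> y)"
    and conj_absorb: "x \<sqinter> (x \<squnion> y) = x"
    and mem: "(x \<squnion> y) \<sqinter> z = (\<sim> x \<sqinter> (y \<sqinter> z)) \<squnion> (x \<sqinter> z)"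
    and com: "(x \<sqinter> y) \<squnion> (y \<sqinter> x) = (y \<sqinter> x) \<squnion> (x \<sqinter> y)"
begin

section \<open>De Morgan duality and contradictions\<close>

lemma neg_disj: "\<sim> (x \<squnion> y) = \<sim> x \<sqinter> \<sim> y"
  by (simp add: disj_eq dneg)

lemma neg_conj: "\<sim> (x \<sqinter> y) = \<sim> x \<squnion> \<sim> y"
  by (simp add: disj_eq dneg)

lemma disj_absorb: "x \<squnion> (x \<sqinter> y) = x"
  by (metis conj_absorb dneg neg_conj neg_disj)

lemma conj_idem: "x \<sqinter> x = x"
  by (metis conj_absorb disj_absorb)

lemma conj_excluded_middle: "x \<sqinter> (\<sim> x \<squnion> x) = x"
  by (metis mem disj_eq conj_idem dneg)

lemma conj_conj_neg: "x \<sqinter> (x \<sqinter> \<sim> x) = x \<sqinter> \<sim> x"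
  by (metis conj_absorb disj_eq mem dneg conj_idem conj_excluded_middle)

lemma conj_neg_commute: "x \<sqinter> \<sim> x = \<sim> x \<sqinter> x"
  by (metis mem disj_eq dneg conj_excluded_middle conj_absorb conj_idem conj_conj_neg)

text \<open>The contradiction \<open>x \<sqinter> \<sim> x\<close> serves as a falsehood relative to
  \<open>x\<close>: a left zero of conjunction and, by \<open>contradiction_disj_conj\<close>, a
  left unit of disjunction in front of conjunctions that start with \<open>x\<close>.\<close>

lemma conj_neg_left_zero: "(x \<sqinter> \<sim> x) \<sqinter> y = x \<sqinter> \<sim> x"
  by (metis mem disj_eq conj_absorb dneg conj_conj_neg conj_neg_commute conj_idem)

lemma contradiction_disj_conj: "(x \<sqinter> \<sim> x) \<squnion> (x \<sqinter> y) = x \<sqinter> y"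
  by (metis conj_absorb disj_eq mem dneg conj_idem conj_conj_neg conj_neg_commute)

lemma neg_contradiction_conj: "\<sim> (x \<sqinter> \<sim> x) \<sqinter> (x \<sqinter> y) = x \<sqinter> y"
  by (metis contradiction_disj_conj disj_eq dneg conj_neg_commute conj_neg_left_zero)

text \<open>Expanding \<open>(\<sim> x \<squnion> \<sim> y) \<sqinter> x\<close> by
  \<open>mem\<close> leaves the further disjunct \<open>\<sim> x \<sqinter> x\<close>, a
  contradiction that the first disjunct absorbs.\<close>

lemma neg_conj_conj: "\<sim> (x \<sqinter> y) \<sqinter> x = x \<sqinter> (\<sim> y \<sqinter> x)"
  by (metis conj_absorb disj_eq dneg mem neg_contradiction_conj conj_neg_commute conj_neg_left_zero)

text \<open>A precursor of distributivity: the last two occurrences of \<open>x\<close>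
  can only be dropped once \<open>conj_memory\<close> is known.\<close>

lemma conj_disj_conj_near: "(x \<sqinter> y) \<squnion> (x \<sqinter> z) = x \<sqinter> ((y \<squnion> (x \<sqinter> z)) \<sqinter> x)"
proof -
  have "\<sim> (x \<sqinter> y) \<sqinter> \<sim> (x \<sqinter> z) = (x \<sqinter> (\<sim> y \<sqinter> \<sim> (x \<sqinter> z))) \<squnion> \<sim> x"
    using mem[of "\<sim> x" "\<sim> y" "\<sim> (x \<sqinter> z)"] by (simp add: neg_conj dneg conj_absorb)
  then have "(x \<sqinter> y) \<squnion> (x \<sqinter> z) = \<sim> (x \<sqinter> (\<sim> y \<sqinter> \<sim> (x \<sqinter> z))) \<sqinter> x"
    by (metis neg_conj neg_disj dneg)
  then show ?thesis
    by (simp only: neg_conj_conj flip: disj_eq)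
qed

lemma conj_neg_conj: "x \<sqinter> (\<sim> x \<sqinter> y) = x \<sqinter> \<sim> x"
  by (metis conj_disj_conj_near disj_eq contradiction_disj_conj mem conj_conj_neg neg_conj_conj
      dneg conj_absorb conj_neg_left_zero conj_neg_commute)

section \<open>Repeated conjuncts and memory\<close>

lemma conj_neg_conj_neg_conj: "x \<sqinter> \<sim> (x \<sqinter> \<sim> (x \<sqinter> y)) = x \<sqinter> y"
  by (metis conj_absorb disj_eq dneg conj_disj_conj_near contradiction_disj_conj mem
      conj_neg_conj conj_neg_commute conj_conj_neg neg_conj_conj)

text \<open>In \<open>conj_disj_conj_near\<close> let the first disjunct be built from
  \<open>y = x \<sqinter> \<sim> x\<close>; \<open>contradiction_disj_conj\<close> then deletes it
  on both sides.\<close>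

lemma conj_conj_conj_self: "x \<sqinter> ((x \<sqinter> y) \<sqinter> x) = x \<sqinter> y"
  by (metis conj_disj_conj_near disj_eq contradiction_disj_conj conj_conj_neg)

lemma conj_neg_conj_self: "x \<sqinter> \<sim> (x \<sqinter> y) = x \<sqinter> (\<sim> y \<sqinter> x)"
  by (metis neg_conj_conj conj_neg_conj_neg_conj dneg conj_conj_conj_self)

lemma conj_neg_neg_conj: "x \<sqinter> (\<sim> (\<sim> y \<sqinter> x) \<sqinter> x) = x \<sqinter> y"
  by (metis conj_neg_conj_neg_conj conj_neg_conj_self)

lemma conj_left_idem: "x \<sqinter> (x \<sqinter> y) = x \<sqinter> y"
  by (metis conj_neg_conj_self dneg conj_conj_conj_self neg_conj_conj contradiction_disj_conj
      disj_eq conj_neg_conj conj_neg_commute conj_neg_left_zero neg_contradiction_conj)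

lemma conj_conj_self: "(x \<sqinter> y) \<sqinter> x = x \<sqinter> y"
  by (metis conj_neg_conj_self dneg conj_conj_conj_self conj_left_idem conj_idem
      neg_contradiction_conj conj_neg_conj conj_neg_commute)

text \<open>\<open>mem\<close> rewrites \<open>(x \<squnion> y) \<sqinter> z\<close> to a
  disjunction of the form occurring in \<open>conj_disj_conj_near\<close>. The corresponding first
  disjunct begins with \<open>x \<sqinter> \<sim> x\<close> and vanishes.\<close>

lemma conj_disj_conj: "x \<sqinter> (((x \<squnion> y) \<sqinter> z) \<sqinter> x) = x \<sqinter> z"
  by (metis contradiction_disj_conj disj_eq conj_disj_conj_near mem dneg conj_neg_conj)

lemma conj_conj_neg_conj_self: "(x \<sqinter> y) \<sqinter> \<sim> (x \<sqinter> y) = (x \<sqinter> y) \<sqinter> \<sim> x"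
  by (metis conj_neg_neg_conj dneg conj_left_idem conj_neg_commute)

lemma conj_contradiction: "(x \<sqinter> y) \<sqinter> (x \<sqinter> \<sim> x) = (x \<sqinter> y) \<sqinter> \<sim> x"
  by (metis conj_conj_neg_conj_self neg_contradiction_conj dneg)

text \<open>By \<open>mem\<close> the second disjunct matters only through its conjunction with
  \<open>y\<close>, which is \<open>y\<close> in both cases.\<close>

lemma disj_neg_contradiction_conj: "(x \<squnion> \<sim> (y \<sqinter> \<sim> y)) \<sqinter> y = (x \<squnion> y) \<sqinter> y"
proof -
  have "\<sim> (y \<sqinter> \<sim> y) \<sqinter> y = y"
    using neg_contradiction_conj[of y y] by (simp only: conj_idem)
  then show ?thesis
    by (simp only: mem conj_idem)
qed

lemma neg_conj_contradiction: "\<sim> (x \<sqinter> (y \<sqinter> \<sim> y)) \<sqinter> \<sim> y = \<sim> (x \<sqinter> y) \<sqinter> \<sim> y"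
  using disj_neg_contradiction_conj[of "\<sim> x" "\<sim> y"]
  by (simp only: disj_eq dneg conj_neg_commute[of y])

lemma neg_conj_conj_neg: "\<sim> ((x \<sqinter> y) \<sqinter> \<sim> x) \<sqinter> \<sim> x = \<sim> (x \<sqinter> y) \<sqinter> \<sim> x"
  by (metis neg_conj_contradiction conj_contradiction conj_conj_self)

lemma conj_disj_self_conj: "((x \<sqinter> y) \<squnion> x) \<sqinter> y = x \<sqinter> y"
proof -
  \<comment> \<open>The first disjunct is traded for the contradiction of
    \<open>x \<sqinter> y\<close>. In the expansion by \<open>mem\<close> its negation then
    disappears in front of \<open>x \<sqinter> y\<close>, and it swallows the \<open>y\<close>
    behind it.\<close>
  have "(x \<sqinter> y) \<squnion> x = ((x \<sqinter> y) \<sqinter> \<sim> x) \<squnion> x"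
    by (simp only: disj_eq neg_conj_conj_neg)
  then have "((x \<sqinter> y) \<squnion> x) \<sqinter> y =
      (\<sim> ((x \<sqinter> y) \<sqinter> \<sim> x) \<sqinter> (x \<sqinter> y)) \<squnion> (((x \<sqinter> y) \<sqinter> \<sim> x) \<sqinter> y)"
    by (simp only: mem)
  also have "\<dots> = (x \<sqinter> y) \<squnion> ((x \<sqinter> y) \<sqinter> \<sim> x)"
    by (metis conj_conj_neg_conj_self neg_contradiction_conj conj_idem conj_neg_left_zero)
  also have "\<dots> = x \<sqinter> y"
    by (rule disj_absorb)
  finally show ?thesis .
qed

lemma conj_right_idem: "(x \<sqinter> y) \<sqinter> y = x \<sqinter> y"
  by (metis conj_disj_conj conj_disj_self_conj conj_idem)

lemma conj_neg_conj_right: "x \<sqinter> \<sim> (y \<sqinter> x) = x \<sqinter> \<sim> y"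
  by (metis conj_neg_neg_conj dneg conj_right_idem)

lemma conj_neg_conj_disj: "x \<sqinter> \<sim> (y \<sqinter> (x \<squnion> z)) = x \<sqinter> \<sim> y"
  by (metis conj_disj_conj disj_eq conj_left_idem dneg conj_neg_conj_right)

lemma conj_neg_disj_conj: "x \<sqinter> (\<sim> (x \<sqinter> \<sim> y) \<sqinter> z) = x \<sqinter> (y \<sqinter> z)"
  by (metis conj_neg_conj_disj disj_eq dneg mem conj_left_idem)

lemma conj_memory_right: "x \<sqinter> ((y \<sqinter> x) \<sqinter> z) = x \<sqinter> (y \<sqinter> z)"
  by (metis conj_neg_disj_conj conj_neg_conj_right)

text \<open>The memory law: a later occurrence of \<open>x\<close> repeats a value already known. It
  is \<open>conj_memory_right\<close> with \<open>z = y\<close>.\<close>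

lemma conj_memory: "x \<sqinter> (y \<sqinter> x) = x \<sqinter> y"
  by (metis conj_memory_right conj_conj_self conj_idem)

lemma conj_neg_disj: "x \<sqinter> (\<sim> x \<squnion> y) = x \<sqinter> y"
  by (metis disj_eq dneg conj_neg_conj_self conj_memory)

lemma conj_neg_conj_left: "x \<sqinter> \<sim> (x \<sqinter> y) = x \<sqinter> \<sim> y"
  by (metis conj_neg_conj_self conj_memory)

lemma neg_conj_conj_self: "\<sim> (x \<sqinter> y) \<sqinter> x = x \<sqinter> \<sim> y"
  by (metis neg_conj_conj conj_memory)

lemma conj_memory_left: "x \<sqinter> ((x \<sqinter> y) \<sqinter> z) = x \<sqinter> (y \<sqinter> z)"
  by (metis conj_neg_disj_conj conj_neg_conj_left)

lemma conj_conj_conj: "(x \<sqinter> y) \<sqinter> (x \<sqinter> z) = (x \<sqinter> y) \<sqinter> z"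
  by (metis conj_memory_right conj_left_idem)

lemma conj_conj_neg_conj: "(x \<sqinter> y) \<sqinter> \<sim> (x \<sqinter> z) = (x \<sqinter> y) \<sqinter> \<sim> z"
  by (metis conj_neg_conj_left conj_conj_conj)

lemma conj_memory_middle: "x \<sqinter> (y \<sqinter> (x \<sqinter> z)) = x \<sqinter> (y \<sqinter> z)"
  by (metis conj_memory_left conj_left_idem conj_memory_right)

lemma conj_neg_conj_neg: "x \<sqinter> (\<sim> y \<sqinter> \<sim> x) = x \<sqinter> (y \<sqinter> \<sim> x)"
  by (metis conj_memory_middle conj_neg_conj_left conj_neg_conj_right conj_memory_left dneg
      neg_conj_conj_self)

lemma conj_conj_shared: "(x \<sqinter> y) \<sqinter> (y \<sqinter> z) = (x \<sqinter> y) \<sqinter> z"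
  by (metis conj_memory_middle conj_memory_left conj_conj_conj)

lemma disj_conj_conj: "(x \<squnion> (y \<sqinter> z)) \<sqinter> z = (x \<squnion> y) \<sqinter> z"
  by (metis mem disj_eq conj_right_idem)

lemma conj_neg_memory_left: "x \<sqinter> \<sim> ((x \<sqinter> y) \<sqinter> z) = x \<sqinter> \<sim> (y \<sqinter> z)"
  by (metis conj_neg_conj_left conj_memory_left)

lemma neg_conj_absorb: "\<sim> (x \<sqinter> y) \<sqinter> \<sim> (x \<sqinter> (y \<sqinter> z)) = \<sim> (x \<sqinter> y)"
  by (metis conj_neg_conj_left conj_neg_conj dneg conj_idem conj_conj_neg_conj
      conj_neg_memory_left conj_memory_left conj_left_idem)

section \<open>Associativity and distributivity\<close>

lemma conj_neg_shared: "(x \<sqinter> \<sim> (y \<sqinter> \<sim> x)) \<sqinter> (y \<sqinter> z) = (x \<sqinter> y) \<sqinter> z"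
  by (metis conj_disj_conj_near disj_eq conj_memory_left conj_neg_conj conj_neg_left_zero
      conj_left_idem disj_conj_conj conj_memory conj_neg_memory_left conj_neg_conj_left dneg
      conj_idem conj_neg_conj_neg neg_conj_absorb conj_conj_shared)

lemma neg_conj_distrib: "\<sim> (x \<sqinter> y) \<sqinter> (x \<sqinter> z) = (x \<sqinter> \<sim> y) \<sqinter> z"
  \<comment> \<open>With this instance the guard \<open>\<sim> (y \<sqinter> \<sim> x)\<close>
    becomes a second copy of \<open>\<sim> (x \<sqinter> y)\<close>, which idempotence
    removes.\<close>
  using conj_neg_shared[of "\<sim> (x \<sqinter> y)" x z]
  by (simp add: neg_conj_conj_self conj_left_idem conj_idem dneg)

lemma conj_conj_right_idem: "(x \<sqinter> (y \<sqinter> z)) \<sqinter> z = x \<sqinter> (y \<sqinter> z)"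
  by (metis conj_conj_shared conj_right_idem)

text \<open>Both sides equal
  \<open>\<sim> (x \<sqinter> \<sim> y) \<sqinter> (x \<sqinter> z)\<close>: the left one by
  \<open>neg_conj_distrib\<close>, the right one by the same law after \<open>disj_conj_conj\<close>
  has replaced \<open>y\<close> by \<open>y \<sqinter> (x \<sqinter> z)\<close>.\<close>

lemma conj_assoc: "(x \<sqinter> y) \<sqinter> z = x \<sqinter> (y \<sqinter> z)"
  by (metis disj_conj_conj disj_eq neg_conj_distrib dneg conj_memory_middle conj_conj_right_idem)

lemma conj_disj_distrib: "x \<sqinter> (y \<squnion> z) = (x \<sqinter> y) \<squnion> (x \<sqinter> z)"
  by (metis conj_disj_conj_near disj_eq conj_memory conj_conj_neg_conj conj_assoc
      conj_neg_conj_left)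

lemma conj_disj_absorb: "x \<sqinter> (y \<sqinter> (x \<squnion> z)) = x \<sqinter> y"
proof -
  have "x \<sqinter> (y \<sqinter> (x \<squnion> z)) = ((x \<sqinter> y) \<sqinter> x) \<squnion> ((x \<sqinter> y) \<sqinter> z)"
    by (simp only: conj_assoc conj_disj_distrib)
  then show ?thesis
    by (simp only: conj_conj_self disj_absorb)
qed

text \<open>\<open>mem\<close> splits the product into two branches. In the branch of
  \<open>x\<close> the factor \<open>\<sim> x \<squnion> y\<close> reduces to \<open>y\<close>; in
  that of \<open>\<sim> x\<close> it adds nothing.\<close>

lemma disj_conj_disj: "(x \<squnion> z) \<sqinter> (\<sim> x \<squnion> y) = (\<sim> x \<sqinter> z) \<squnion> (x \<sqinter> y)"
  by (simp only: mem[of x z] conj_neg_disj conj_disj_absorb)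

lemma disj_assoc: "(x \<squnion> y) \<squnion> z = x \<squnion> (y \<squnion> z)"
  by (simp only: disj_eq dneg conj_assoc)

lemma disj_disj_self: "x \<squnion> (y \<squnion> x) = x \<squnion> y"
  by (simp only: disj_eq dneg conj_memory)

lemma disj_swap: "(\<sim> x \<sqinter> z) \<squnion> (x \<sqinter> y) = (x \<sqinter> y) \<squnion> (\<sim> x \<sqinter> z)" (is "?t \<squnion> ?s = _")
proof -
  have "(?t \<squnion> ?s) \<squnion> (?s \<squnion> ?t) = (?s \<squnion> ?t) \<squnion> (?t \<squnion> ?s)"
    using com[of "x \<squnion> z" "\<sim> x \<squnion> y"] disj_conj_disj[of x z y] disj_conj_disj[of "\<sim> x" y z]
    by (simp only: dneg)
  then show ?thesis
    by (metis disj_assoc disj_disj_self)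
qed

lemma disj_conj: "(x \<squnion> y) \<sqinter> z = (x \<sqinter> z) \<squnion> (\<sim> x \<sqinter> (y \<sqinter> z))"
  by (simp only: mem disj_swap)

end

section \<open>From the axioms of conditional logic to (Mem)\<close>

locale conditional_algebra =
  fixes neg :: "'a \<Rightarrow> 'a"  (\<open>\<sim> _\<close> [80] 80)
    and conj :: "'a \<Rightarrow> 'a \<Rightarrow> 'a"  (infixr \<open>\<sqinter>\<close> 70)
    and disj :: "'a \<Rightarrow> 'a \<Rightarrow> 'a"  (infixr \<open>\<squnion>\<close> 65)
  assumes dneg: "\<sim> \<sim> x = x"
    and neg_conj: "\<sim> (x \<sqinter> y) = \<sim> x \<squnion> \<sim> y"
    and conj_assoc: "(x \<sqinter> y) \<sqinter> z = x \<sqinter> (y \<sqinter> z)"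
    and conj_disj_distrib: "x \<sqinter> (y \<squnion> z) = (x \<sqinter> y) \<squnion> (x \<sqinter> z)"
    and disj_conj: "(x \<squnion> y) \<sqinter> z = (x \<sqinter> z) \<squnion> (\<sim> x \<sqinter> (y \<sqinter> z))"
    and disj_absorb: "x \<squnion> (x \<sqinter> y) = x"
    and com: "(x \<sqinter> y) \<squnion> (y \<sqinter> x) = (y \<sqinter> x) \<squnion> (x \<sqinter> y)"
begin

lemma disj_eq: "x \<squnion> y = \<sim> (\<sim> x \<sqinter> \<sim> y)"
  by (simp add: neg_conj dneg)

lemma neg_disj: "\<sim> (x \<squnion> y) = \<sim> x \<sqinter> \<sim> y"
  by (simp add: disj_eq dneg)

lemma disj_assoc: "(x \<squnion> y) \<squnion> z = x \<squnion> (y \<squnion> z)"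
  by (simp add: disj_eq dneg conj_assoc)

lemma conj_absorb: "x \<sqinter> (x \<squnion> y) = x"
  by (metis disj_absorb dneg neg_conj neg_disj)

lemma conj_idem: "x \<sqinter> x = x"
  by (metis conj_absorb disj_absorb)

text \<open>This simplifies the branch of \<open>x\<close> in \<open>disj_conj_disj\<close>;
  \<open>conj_disj_absorb\<close> simplifies that of \<open>\<sim> x\<close>.\<close>

lemma conj_neg_disj: "x \<sqinter> (\<sim> x \<squnion> y) = x \<sqinter> y"
  by (metis conj_absorb conj_disj_distrib disj_conj conj_idem conj_assoc disj_absorb dneg disj_eq)

lemma disj_disj_self: "x \<squnion> (y \<squnion> x) = x \<squnion> y"
  by (metis conj_absorb conj_disj_distrib disj_conj conj_idem conj_assoc disj_absorb dneg
      disj_eq disj_assoc conj_neg_disj)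

lemma conj_disj_absorb: "x \<sqinter> (y \<sqinter> (x \<squnion> z)) = x \<sqinter> y"
  by (metis conj_absorb conj_disj_distrib conj_idem conj_assoc disj_absorb dneg neg_conj
      neg_disj disj_disj_self)

lemma disj_conj_disj: "(x \<squnion> z) \<sqinter> (\<sim> x \<squnion> y) = (x \<sqinter> y) \<squnion> (\<sim> x \<sqinter> z)"
  by (simp add: disj_conj conj_neg_disj conj_disj_absorb)

lemma disj_swap: "(x \<sqinter> y) \<squnion> (\<sim> x \<sqinter> z) = (\<sim> x \<sqinter> z) \<squnion> (x \<sqinter> y)" (is "?s \<squnion> ?t = _")
proof -
  have "(?s \<squnion> ?t) \<squnion> (?t \<squnion> ?s) = (?t \<squnion> ?s) \<squnion> (?s \<squnion> ?t)"
    using com[of "x \<squnion> z" "\<sim> x \<squnion> y"] disj_conj_disj[of x z y] disj_conj_disj[of "\<sim> x" y z]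
    by (simp add: dneg)
  then show ?thesis by (metis disj_assoc disj_disj_self)
qed

lemma mem: "(x \<squnion> y) \<sqinter> z = (\<sim> x \<sqinter> (y \<sqinter> z)) \<squnion> (x \<sqinter> z)"
  by (simp add: disj_conj disj_swap)

end

text \<open>Absorption gives \<open>t \<squnion> y = t\<close>, so \<open>mem\<close> with
  \<open>x = y = t\<close> reads \<open>z = (\<sim> t \<sqinter> z) \<squnion> z\<close>. Hence
  every \<open>z\<close> is a negation, by \<open>disj_eq\<close>; and for
  \<open>z = \<sim> u\<close> the equation becomes
  \<open>\<sim> u = \<sim> \<sim> \<sim> u\<close>.\<close>

lemma double_negation_from_unit:
  fixes neg :: "'a \<Rightarrow> 'a"  (\<open>\<sim> _\<close> [80] 80)
    and conj :: "'a \<Rightarrow> 'a \<Rightarrow> 'a"  (infixr \<open>\<sqinter>\<close> 70)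
    and disj :: "'a \<Rightarrow> 'a \<Rightarrow> 'a"  (infixr \<open>\<squnion>\<close> 65)
  assumes unit: "\<And>x. t \<sqinter> x = x"
    and disj_eq: "\<And>x y. x \<squnion> y = \<sim> (\<sim> x \<sqinter> \<sim> y)"
    and conj_absorb: "\<And>x y. x \<sqinter> (x \<squnion> y) = x"
    and mem: "\<And>x y z. (x \<squnion> y) \<sqinter> z = (\<sim> x \<sqinter> (y \<sqinter> z)) \<squnion> (x \<sqinter> z)"
  shows "\<sim> \<sim> x = x"
  using assms by metis

section \<open>Completeness of equational logic\<close>

text \<open>One type of algebras serves all four signatures: every constant gets a value, also one
  outside the signature.\<close>

record 'a algebra =
  con :: "cst \<Rightarrow> 'a"
  neg :: "'a \<Rightarrow> 'a"
  conj :: "'a \<Rightarrow> 'a \<Rightarrow> 'a"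
  disj :: "'a \<Rightarrow> 'a \<Rightarrow> 'a"

primrec eval :: "'a algebra \<Rightarrow> (nat \<Rightarrow> 'a) \<Rightarrow> trm \<Rightarrow> 'a" where
  "eval M \<rho> (Var n) = \<rho> n"
| "eval M \<rho> (Cst c) = con M c"
| "eval M \<rho> (\<^bold>\<not> t) = neg M (eval M \<rho> t)"
| "eval M \<rho> (s \<^bold>\<and> t) = conj M (eval M \<rho> s) (eval M \<rho> t)"
| "eval M \<rho> (s \<^bold>\<or> t) = disj M (eval M \<rho> s) (eval M \<rho> t)"

definition satisfies :: "'a algebra \<Rightarrow> eqn \<Rightarrow> bool" (infix \<open>\<Turnstile>\<close> 50) where
  "M \<Turnstile> e \<longleftrightarrow> (\<forall>\<rho>. eval M \<rho> (fst e) = eval M \<rho> (snd e))"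

definition models :: "'a algebra \<Rightarrow> eqn set \<Rightarrow> bool" where
  "models M E \<longleftrightarrow> (\<forall>e \<in> E. M \<Turnstile> e)"

lemma models_simps [simp]:
  "models M {}"
  "models M (insert e E) \<longleftrightarrow> M \<Turnstile> e \<and> models M E"
  "models M (E \<union> E') \<longleftrightarrow> models M E \<and> models M E'"
  by (auto simp: models_def)

lemma eval_subst: "eval M \<rho> (subst \<sigma> t) = eval M (\<lambda>n. eval M \<rho> (\<sigma> n)) t"
  by (induction t) auto

lemma subst_Var [simp]: "subst Var t = t"
  by (induction t) auto

lemma terms_simps [simp]:
  "Var n \<in> terms C"
  "Cst c \<in> terms C \<longleftrightarrow> c \<in> C"
  "\<^bold>\<not> t \<in> terms C \<longleftrightarrow> t \<in> terms C"
  "s \<^bold>\<and> t \<in> terms C \<longleftrightarrow> s \<in> terms C \<and> t \<in> terms C"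
  "s \<^bold>\<or> t \<in> terms C \<longleftrightarrow> s \<in> terms C \<and> t \<in> terms C"
  by (auto simp: terms_def)

lemma derivable_sound:
  assumes "derivable C E e" "models M E"
  shows "M \<Turnstile> e"
  using assms by (induction rule: derivable.induct) (auto simp: satisfies_def models_def eval_subst)

instance cst :: countable
  by countable_datatype

instance trm :: countable
  by countable_datatype

text \<open>\<open>q\<close> sends a term to the number of its derivability class. A fixed carrier
  is needed because a hypothesis cannot quantify over types.\<close>

lemma quotient_on_nat:
  fixes M :: "'a algebra" and a b :: 'a
  assumes sound: "models M E" and nontrivial: "a \<noteq> b"
  obtains q :: "trm \<Rightarrow> nat" where "q ` terms C = UNIV"
    and "\<And>s t. s \<in> terms C \<Longrightarrow> t \<in> terms C \<Longrightarrow> q s = q t \<longleftrightarrow> derivable C E (s, t)"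
proof -
  define cls where "cls t = {s \<in> terms C. derivable C E (s, t)}" for t
  define K where "K = cls ` terms C"
  have cls_eq: "cls s = cls t \<longleftrightarrow> derivable C E (s, t)" if "s \<in> terms C" "t \<in> terms C" for s t
    using that unfolding cls_def by (blast intro: derivable.refl derivable.sym derivable.trans)
  have Var_inj: "m = n" if "derivable C E (Var m, Var n)" for m n
  proof (rule ccontr)
    assume "m \<noteq> n"
    moreover have "\<rho> m = \<rho> n" for \<rho> :: "nat \<Rightarrow> 'a"
      using derivable_sound[OF that sound] by (simp add: satisfies_def)
    \<comment> \<open>This valuation separates the two variables in the nontrivial model, so there
      are infinitely many classes.\<close>
    from this[of "\<lambda>k. if k = m then a else b"] have "m = n \<or> a = b"
      by (simp split: if_splits)
    ultimately show False
      using nontrivial by blast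
  qed
  have "inj (\<lambda>n. cls (Var n))"
    by (rule injI) (simp add: cls_eq Var_inj)
  then have "infinite (range (\<lambda>n. cls (Var n)))"
    by (rule range_inj_infinite)
  moreover have "range (\<lambda>n. cls (Var n)) \<subseteq> K"
    by (auto simp: K_def)
  ultimately have "infinite K"
    using finite_subset by blast
  moreover have "countable K"
    by (simp add: K_def)
  ultimately have bij: "bij_betw (to_nat_on K) K UNIV"
    by (simp add: to_nat_on_infinite)
  show thesis
  proof
    show "(\<lambda>t. to_nat_on K (cls t)) ` terms C = UNIV"
      using bij by (metis K_def bij_betw_def image_image)
    show "to_nat_on K (cls s) = to_nat_on K (cls t) \<longleftrightarrow> derivable C E (s, t)"
      if "s \<in> terms C" "t \<in> terms C" for s t
      using bij that cls_eq by (metis K_def bij_betw_def image_eqI inj_on_def)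
  qed
qed

lemma derivable_complete:
  fixes M :: "'a algebra" and a b :: 'a
  assumes E: "E \<subseteq> equations C" and e: "e \<in> equations C"
    and M: "models M E" "a \<noteq> b"
    and valid: "\<And>N :: nat algebra. models N E \<Longrightarrow> N \<Turnstile> e"
  shows "derivable C E e"
proof -
  obtain q :: "trm \<Rightarrow> nat" where q_surj: "q ` terms C = UNIV"
    and q_eq: "\<And>s t. s \<in> terms C \<Longrightarrow> t \<in> terms C \<Longrightarrow> q s = q t \<longleftrightarrow> derivable C E (s, t)"
    using quotient_on_nat[OF M, of C] by metis
  \<comment> \<open>\<open>r\<close> picks a representative term of each class.\<close>
  define r where "r = inv_into (terms C) q"
  have r: "r k \<in> terms C" "q (r k) = k" for k
    using q_surj by (simp_all add: r_def inv_into_into f_inv_into_f)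
  \<comment> \<open>The term algebra modulo derivability, carried over to numbers. A constant
    outside \<open>C\<close> gets some value, which no equation over \<open>C\<close>
    mentions.\<close>
  define N where "N = \<lparr>con = \<lambda>c. q (Cst c), neg = \<lambda>i. q (\<^bold>\<not> r i),
    conj = \<lambda>i j. q (r i \<^bold>\<and> r j), disj = \<lambda>i j. q (r i \<^bold>\<or> r j)\<rparr>"
  have rq: "derivable C E (r (q t), t)" if "t \<in> terms C" for t
    using r that q_eq by blast
  have eval_N: "t \<in> terms C \<Longrightarrow> subst \<sigma> t \<in> terms C \<and> eval N (q \<circ> \<sigma>) t = q (subst \<sigma> t)"
    if "\<And>n. \<sigma> n \<in> terms C" for t and \<sigma> :: "nat \<Rightarrow> trm"
    by (induction t)
      (auto simp: that N_def q_eq r intro!: derivable.cong_Neg derivable.cong_Conj derivable.cong_Disj rq)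
  have "N \<Turnstile> d" if d_in: "d \<in> E" for d
    unfolding satisfies_def
  proof
    fix \<rho> :: "nat \<Rightarrow> nat"
    obtain s t where d: "d = (s, t)" "s \<in> terms C" "t \<in> terms C"
      using d_in E by (auto simp: equations_def)
    \<comment> \<open>Representatives lift any valuation in the quotient to a substitution.\<close>
    define \<sigma> where "\<sigma> = r \<circ> \<rho>"
    have \<sigma>: "\<sigma> n \<in> terms C" for n
      by (simp add: \<sigma>_def r)
    have \<rho>: "q \<circ> \<sigma> = \<rho>"
      by (auto simp: \<sigma>_def r)
    have "derivable C E (subst \<sigma> s, subst \<sigma> t)"
      using d_in E \<sigma> d(1) by (blast intro: derivable.intros)
    then have "q (subst \<sigma> s) = q (subst \<sigma> t)"
      using eval_N[of \<sigma> s] eval_N[of \<sigma> t] \<sigma> d q_eq by blast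
    then show "eval N \<rho> (fst d) = eval N \<rho> (snd d)"
      using eval_N[of \<sigma> s] eval_N[of \<sigma> t] \<sigma> d by (simp add: \<rho>)
  qed
  then have "N \<Turnstile> e"
    by (simp add: valid models_def)
  moreover obtain s t where st: "e = (s, t)" "s \<in> terms C" "t \<in> terms C"
    using e by (auto simp: equations_def)
  ultimately have "q s = q t"
    \<comment> \<open>Under the identity substitution each term evaluates to its own class.\<close>
    using eval_N[of Var s] eval_N[of Var t] by (simp add: satisfies_def)
  then show ?thesis
    using st q_eq by blast
qed

text \<open>The single algebra \<open>M\<close> supplies the nontrivial model that completeness
  requires for \<open>E\<close> and for \<open>L\<close>.\<close>

lemma completely_axiomatisesI:
  fixes M :: "'a algebra" and a b :: 'a
  assumes "E \<subseteq> equations C" "L \<subseteq> equations C"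
    and "\<And>N :: nat algebra. models N E \<longleftrightarrow> models N L"
    and "models M E" "models M L" "a \<noteq> b"
  shows "completely_axiomatises C E L"
  unfolding completely_axiomatises_def
proof (intro conjI ballI iffI)
  show "E \<subseteq> equations C"
    by (rule assms)
next
  fix e assume "e \<in> equations C" "derivable C E e"
  then show "derivable C L e"
    using derivable_complete[of L C e M a b] derivable_sound[of C E e] assms by blast
next
  fix e assume "e \<in> equations C" "derivable C L e"
  then show "derivable C E e"
    using derivable_complete[of E C e M a b] derivable_sound[of C L e] assms by blast
qed

lemma not_derivable_from_others:
  assumes "\<not> M \<Turnstile> e" "\<forall>d \<in> E. d = e \<or> M \<Turnstile> d"
  shows "\<not> derivable C (E - {e}) e"
  using assms derivable_sound[of C "E - {e}" e M] by (auto simp: models_def)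

section \<open>Models of the axiom systems\<close>

lemma all_valuations:
  "(\<forall>\<rho> :: nat \<Rightarrow> 'a. P (\<rho> 0)) \<longleftrightarrow> (\<forall>x. P x)"
  "(\<forall>\<rho> :: nat \<Rightarrow> 'a. Q (\<rho> 0) (\<rho> 1)) \<longleftrightarrow> (\<forall>x y. Q x y)"
  "(\<forall>\<rho> :: nat \<Rightarrow> 'a. R (\<rho> 0) (\<rho> 1) (\<rho> 2)) \<longleftrightarrow> (\<forall>x y z. R x y z)"
proof -
  have *: "\<exists>\<rho> :: nat \<Rightarrow> 'a. \<rho> 0 = x \<and> \<rho> 1 = y \<and> \<rho> 2 = z" for x y z
    by (rule exI[of _ "\<lambda>n. if n = 0 then x else if n = 1 then y else z"]) simp
  show "(\<forall>\<rho> :: nat \<Rightarrow> 'a. P (\<rho> 0)) \<longleftrightarrow> (\<forall>x. P x)"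
    using * by metis
  show "(\<forall>\<rho> :: nat \<Rightarrow> 'a. Q (\<rho> 0) (\<rho> 1)) \<longleftrightarrow> (\<forall>x y. Q x y)"
    using * by metis
  show "(\<forall>\<rho> :: nat \<Rightarrow> 'a. R (\<rho> 0) (\<rho> 1) (\<rho> 2)) \<longleftrightarrow> (\<forall>x y z. R x y z)"
    using * by metis
qed

lemma satisfies_iff:
  "M \<Turnstile> DNeg_eq \<longleftrightarrow> (\<forall>x. neg M (neg M x) = x)"
  "M \<Turnstile> Neg_eq \<longleftrightarrow> con M CF = neg M (con M CT)"
  "M \<Turnstile> Or_eq \<longleftrightarrow> (\<forall>x y. disj M x y = neg M (conj M (neg M x) (neg M y)))"
  "M \<Turnstile> Tand_eq \<longleftrightarrow> (\<forall>x. conj M (con M CT) x = x)"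
  "M \<Turnstile> Abs_eq \<longleftrightarrow> (\<forall>x y. conj M x (disj M x y) = x)"
  "M \<Turnstile> Mem_eq \<longleftrightarrow> (\<forall>x y z. conj M (disj M x y) z =
     disj M (conj M (neg M x) (conj M y z)) (conj M x z))"
  "M \<Turnstile> Com_eq \<longleftrightarrow> (\<forall>x y. disj M (conj M x y) (conj M y x) = disj M (conj M y x) (conj M x y))"
  "M \<Turnstile> Und_eq \<longleftrightarrow> neg M (con M CU) = con M CU"
  by (simp_all only: satisfies_def DNeg_eq_def Neg_eq_def Or_eq_def Tand_eq_def Abs_eq_def
      Mem_eq_def Com_eq_def Und_eq_def eval.simps fst_conv snd_conv simp_thms)
    (rule all_valuations)+

lemma models_CL_iff:
  "models M CL \<longleftrightarrow> conditional_algebra (neg M) (conj M) (disj M)"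
  by (simp only: CL_def models_simps satisfies_def eval.simps fst_conv snd_conv simp_thms
      conditional_algebra_def conj_assoc)
    (intro conj_cong all_valuations)

lemma models_memorising_iff:
  "models M {DNeg_eq, Or_eq, Abs_eq, Mem_eq, Com_eq} \<longleftrightarrow>
     memorising_algebra (neg M) (conj M) (disj M)"
  by (simp only: models_simps satisfies_iff memorising_algebra_def simp_thms conj_assoc)

lemma memorising_iff_conditional:
  "memorising_algebra n k d \<longleftrightarrow> conditional_algebra n k d"
proof
  assume "memorising_algebra n k d"
  then interpret memorising_algebra n k d .
  show "conditional_algebra n k d"
    by unfold_locales
      (fact dneg neg_conj conj_assoc conj_disj_distrib disj_conj disj_absorb com)+
next
  assume "conditional_algebra n k d"
  then interpret conditional_algebra n k d .
  show "memorising_algebra n k d"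
    by unfold_locales (fact dneg disj_eq conj_absorb mem com)+
qed

lemma models_axioms_iff:
  "models M {DNeg_eq, Or_eq, Abs_eq, Mem_eq, Com_eq} \<longleftrightarrow> models M CL"
  by (simp only: models_memorising_iff models_CL_iff memorising_iff_conditional)

text \<open>With \<open>T\<close> in the signature, (Tand) thus takes the place of the double
  negation axiom.\<close>

lemma satisfies_DNeg_if_unit:
  assumes "models M {Or_eq, Tand_eq, Abs_eq, Mem_eq}"
  shows "M \<Turnstile> DNeg_eq"
proof -
  have "M \<Turnstile> Tand_eq" "M \<Turnstile> Or_eq" "M \<Turnstile> Abs_eq" "M \<Turnstile> Mem_eq"
    using assms by simp_all
  note this[unfolded satisfies_iff, rule_format]
  from double_negation_from_unit[of "conj M", OF this] show ?thesis
    by (simp add: satisfies_iff)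
qed

lemma models_CL2_iff:
  "models M CL2 \<longleftrightarrow> models M {Neg_eq, Or_eq, Tand_eq, Abs_eq, Mem_eq, Com_eq}"
  using satisfies_DNeg_if_unit[of M] models_axioms_iff[of M]
  by (auto simp: CL2_def Neg_eq_def Tand_eq_def satisfies_def)

lemma models_CLU_iff:
  "models M CLU \<longleftrightarrow> models M {DNeg_eq, Und_eq, Or_eq, Abs_eq, Mem_eq, Com_eq}"
  using models_axioms_iff[of M] by (auto simp: CLU_def Und_eq_def)

lemma models_CL3_iff:
  "models M CL3 \<longleftrightarrow> models M {Neg_eq, Or_eq, Tand_eq, Abs_eq, Mem_eq, Com_eq, Und_eq}"
  using satisfies_DNeg_if_unit[of M] models_axioms_iff[of M]
  by (auto simp: CL3_def Neg_eq_def Tand_eq_def Und_eq_def satisfies_def)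

lemma equations_simps [simp]:
  "(s, t) \<in> equations C \<longleftrightarrow> s \<in> terms C \<and> t \<in> terms C"
  by (simp add: equations_def)

lemma axioms_equations:
  "CL \<subseteq> equations C"
  "{DNeg_eq, Or_eq, Abs_eq, Mem_eq, Com_eq} \<subseteq> equations C"
  "CT \<in> C \<Longrightarrow> CF \<in> C \<Longrightarrow> {Neg_eq, Tand_eq} \<subseteq> equations C"
  "CU \<in> C \<Longrightarrow> Und_eq \<in> equations C"
  by (simp_all add: CL_def DNeg_eq_def Neg_eq_def Or_eq_def Tand_eq_def Abs_eq_def Mem_eq_def
      Com_eq_def Und_eq_def)

section \<open>Independence\<close>

fun kneg :: "cst \<Rightarrow> cst" where
  "kneg CT = CF"
| "kneg CF = CT"
| "kneg CU = CU"

lemma all_cst: "(\<forall>x. P x) \<longleftrightarrow> P CT \<and> P CF \<and> P CU"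
  by (metis cst.exhaust)

text \<open>Disjunction is defined by (Or), which therefore holds by construction.\<close>

definition de_morgan_algebra :: "(cst \<Rightarrow> 'a) \<Rightarrow> ('a \<Rightarrow> 'a) \<Rightarrow> ('a \<Rightarrow> 'a \<Rightarrow> 'a) \<Rightarrow> 'a algebra" where
  "de_morgan_algebra c n k = \<lparr>con = c, neg = n, conj = k, disj = \<lambda>x y. n (k (n x) (n y))\<rparr>"

text \<open>The algebra \<open>C\<close> with its constants reinterpreted by \<open>c\<close>; only
  the axioms that mention constants depend on \<open>c\<close>.\<close>

abbreviation three_valued :: "(cst \<Rightarrow> cst) \<Rightarrow> cst algebra" where
  "three_valued c \<equiv> de_morgan_algebra c kneg (\<lambda>x y. if x = CT then y else x)"

lemma three_valued:
  "three_valued c \<Turnstile> DNeg_eq" "three_valued c \<Turnstile> Or_eq" "three_valued c \<Turnstile> Abs_eq"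
  "three_valued c \<Turnstile> Mem_eq" "three_valued c \<Turnstile> Com_eq"
  "three_valued c \<Turnstile> Neg_eq \<longleftrightarrow> c CF = kneg (c CT)"
  "three_valued c \<Turnstile> Tand_eq \<longleftrightarrow> c CT = CT"
  "three_valued c \<Turnstile> Und_eq \<longleftrightarrow> c CU = CU"
  by (auto simp: satisfies_iff de_morgan_algebra_def all_cst elim: kneg.elims)

text \<open>Every disjunction is \<open>True\<close> and conjunction is the left projection, so
  (Mem) and (Com) read \<open>True = True\<close>.\<close>

definition dneg_countermodel :: "bool algebra" where
  "dneg_countermodel = de_morgan_algebra (\<lambda>_. True) (\<lambda>_. True) (\<lambda>x y. x)"

text \<open>Conjunction overrides its first argument by its second, with \<open>CU\<close> as
  two-sided unit; disjunction is the commutative meet of the flat order with bottom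
  \<open>CU\<close>. (Or) fails for \<open>CT\<close> and \<open>CF\<close>.\<close>

definition or_countermodel :: "cst algebra" where
  "or_countermodel = \<lparr>con = \<lambda>_. CU, neg = kneg,
     conj = \<lambda>x y. if y = CU then x else y, disj = \<lambda>x y. if x = y then x else CU\<rparr>"

text \<open>Since negation is the identity, disjunction coincides with conjunction and absorption
  fails.\<close>

definition abs_countermodel :: "bool algebra" where
  "abs_countermodel = de_morgan_algebra (\<lambda>_. True) (\<lambda>x. x) (\<and>)"

text \<open>The strong Kleene conjunction, which is commutative. (Mem) fails at
  \<open>x = CU\<close>, \<open>y = z = CT\<close>.\<close>

definition mem_countermodel :: "cst algebra" where
  "mem_countermodel = de_morgan_algebra (\<lambda>c. c) kneg
     (\<lambda>x y. if x = CT then y else if y = CF then CF else x)"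

text \<open>\<open>None\<close> is a second undefined value.\<close>

definition com_countermodel :: "cst option algebra" where
  "com_countermodel = de_morgan_algebra Some (map_option kneg)
     (\<lambda>x y. if x = Some CT then y else x)"

lemma dneg_countermodel:
  "\<not> dneg_countermodel \<Turnstile> DNeg_eq"
  "e \<in> {Neg_eq, Or_eq, Abs_eq, Mem_eq, Com_eq, Und_eq} \<Longrightarrow> dneg_countermodel \<Turnstile> e"
  by (auto simp: satisfies_iff dneg_countermodel_def de_morgan_algebra_def)

lemma neg_countermodel:
  "\<not> three_valued (\<lambda>c. if c = CF then CT else c) \<Turnstile> Neg_eq"
  "e \<in> {DNeg_eq, Or_eq, Tand_eq, Abs_eq, Mem_eq, Com_eq, Und_eq} \<Longrightarrow>
     three_valued (\<lambda>c. if c = CF then CT else c) \<Turnstile> e"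
  by (auto simp: three_valued)

lemma or_countermodel:
  "\<not> or_countermodel \<Turnstile> Or_eq"
  "e \<in> {DNeg_eq, Neg_eq, Tand_eq, Abs_eq, Mem_eq, Com_eq, Und_eq} \<Longrightarrow> or_countermodel \<Turnstile> e"
  by (auto simp: satisfies_iff or_countermodel_def all_cst)

text \<open>\<open>CU\<close> is a fixed point of negation, which saves (Neg) and (Und), but it is a
  left zero instead of a left unit.\<close>

lemma tand_countermodel:
  "\<not> three_valued (\<lambda>_. CU) \<Turnstile> Tand_eq"
  "e \<in> {DNeg_eq, Neg_eq, Or_eq, Abs_eq, Mem_eq, Com_eq, Und_eq} \<Longrightarrow> three_valued (\<lambda>_. CU) \<Turnstile> e"
  by (auto simp: three_valued)

lemma abs_countermodel:
  "\<not> abs_countermodel \<Turnstile> Abs_eq"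
  "e \<in> {DNeg_eq, Neg_eq, Or_eq, Tand_eq, Mem_eq, Com_eq, Und_eq} \<Longrightarrow> abs_countermodel \<Turnstile> e"
  by (auto simp: satisfies_iff abs_countermodel_def de_morgan_algebra_def)

lemma mem_countermodel:
  "\<not> mem_countermodel \<Turnstile> Mem_eq"
  "e \<in> {DNeg_eq, Neg_eq, Or_eq, Tand_eq, Abs_eq, Com_eq, Und_eq} \<Longrightarrow> mem_countermodel \<Turnstile> e"
  by (auto simp: satisfies_iff mem_countermodel_def de_morgan_algebra_def all_cst)

lemma com_countermodel:
  "\<not> com_countermodel \<Turnstile> Com_eq"
  "e \<in> {DNeg_eq, Neg_eq, Or_eq, Tand_eq, Abs_eq, Mem_eq, Und_eq} \<Longrightarrow> com_countermodel \<Turnstile> e"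
  by (auto simp: satisfies_iff com_countermodel_def de_morgan_algebra_def all_cst split_option_all
      split_option_ex)

lemma und_countermodel:
  "\<not> three_valued (\<lambda>c. if c = CU then CT else c) \<Turnstile> Und_eq"
  "e \<in> {DNeg_eq, Neg_eq, Or_eq, Tand_eq, Abs_eq, Mem_eq, Com_eq} \<Longrightarrow>
     three_valued (\<lambda>c. if c = CU then CT else c) \<Turnstile> e"
  by (auto simp: three_valued)

text \<open>(Tand) is excluded because, together with (Or), (Abs) and (Mem), it implies double
  negation.\<close>

lemma not_derivable_DNeg_eq:
  assumes "E \<subseteq> {DNeg_eq, Neg_eq, Or_eq, Abs_eq, Mem_eq, Com_eq, Und_eq}"
  shows "\<not> derivable C (E - {DNeg_eq}) DNeg_eq"
  by (rule not_derivable_from_others[OF dneg_countermodel(1)])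
    (use assms dneg_countermodel(2) in blast)

text \<open>Each countermodel refutes one axiom and satisfies the other seven, so it serves every
  subsystem and every signature.\<close>

lemma not_derivable_from_other_axioms:
  assumes E: "E \<subseteq> {DNeg_eq, Neg_eq, Or_eq, Tand_eq, Abs_eq, Mem_eq, Com_eq, Und_eq}"
    and e: "e \<in> {Neg_eq, Or_eq, Tand_eq, Abs_eq, Mem_eq, Com_eq, Und_eq}"
  shows "\<not> derivable C (E - {e}) e"
proof -
  have "\<not> derivable C (E - {Neg_eq}) Neg_eq"
    by (intro not_derivable_from_others[OF neg_countermodel(1)]) (use E neg_countermodel(2) in blast)
  moreover have "\<not> derivable C (E - {Or_eq}) Or_eq"
    by (intro not_derivable_from_others[OF or_countermodel(1)]) (use E or_countermodel(2) in blast)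
  moreover have "\<not> derivable C (E - {Tand_eq}) Tand_eq"
    by (intro not_derivable_from_others[OF tand_countermodel(1)]) (use E tand_countermodel(2) in blast)
  moreover have "\<not> derivable C (E - {Abs_eq}) Abs_eq"
    by (intro not_derivable_from_others[OF abs_countermodel(1)]) (use E abs_countermodel(2) in blast)
  moreover have "\<not> derivable C (E - {Mem_eq}) Mem_eq"
    by (intro not_derivable_from_others[OF mem_countermodel(1)]) (use E mem_countermodel(2) in blast)
  moreover have "\<not> derivable C (E - {Com_eq}) Com_eq"
    by (intro not_derivable_from_others[OF com_countermodel(1)]) (use E com_countermodel(2) in blast)
  moreover have "\<not> derivable C (E - {Und_eq}) Und_eq"
    by (intro not_derivable_from_others[OF und_countermodel(1)]) (use E und_countermodel(2) in blast)
  ultimately show "\<not> derivable C (E - {e}) e"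
    using e by blast
qed

lemma independent_with_DNeg_eq:
  assumes E: "E \<subseteq> {DNeg_eq, Neg_eq, Or_eq, Abs_eq, Mem_eq, Com_eq, Und_eq}"
  shows "independent C E"
  unfolding independent_def
proof
  fix e assume "e \<in> E"
  show "\<not> derivable C (E - {e}) e"
  proof (cases "e = DNeg_eq")
    case True
    then show ?thesis
      using not_derivable_DNeg_eq[OF E] by simp
  next
    case False
    then show ?thesis
      using E \<open>e \<in> E\<close> by (intro not_derivable_from_other_axioms) auto
  qed
qed

lemma independent_with_Tand_eq:
  assumes E: "E \<subseteq> {Neg_eq, Or_eq, Tand_eq, Abs_eq, Mem_eq, Com_eq, Und_eq}"
  shows "independent C E"
  unfolding independent_def
proof
  fix e assume "e \<in> E"
  then show "\<not> derivable C (E - {e}) e"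
    using E by (intro not_derivable_from_other_axioms) auto
qed

text \<open>The nontrivial model is \<open>C\<close> itself, with its constants denoting
  themselves.\<close>

lemma completely_axiomatises_by_models:
  assumes "E \<subseteq> equations C" "L \<subseteq> equations C"
    and "\<And>N :: nat algebra. models N E \<longleftrightarrow> models N L"
    and "models (three_valued (\<lambda>c. c)) E" "models (three_valued (\<lambda>c. c)) L"
  shows "completely_axiomatises C E L"
  using assms completely_axiomatisesI[of E C L "three_valued (\<lambda>c. c)" CT CF] by blast

theorem theorem5p2:
  "completely_axiomatises {} {DNeg_eq, Or_eq, Abs_eq, Mem_eq, Com_eq} CL
   \<and> independent {} {DNeg_eq, Or_eq, Abs_eq, Mem_eq, Com_eq}
   \<and> completely_axiomatises {CT, CF} {Neg_eq, Or_eq, Tand_eq, Abs_eq, Mem_eq, Com_eq} CL2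
   \<and> independent {CT, CF} {Neg_eq, Or_eq, Tand_eq, Abs_eq, Mem_eq, Com_eq}
   \<and> completely_axiomatises {CU} {DNeg_eq, Und_eq, Or_eq, Abs_eq, Mem_eq, Com_eq} CLU
   \<and> independent {CU} {DNeg_eq, Und_eq, Or_eq, Abs_eq, Mem_eq, Com_eq}
   \<and> completely_axiomatises {CT, CF, CU}
       {Neg_eq, Or_eq, Tand_eq, Abs_eq, Mem_eq, Com_eq, Und_eq} CL3
   \<and> independent {CT, CF, CU}
       {Neg_eq, Or_eq, Tand_eq, Abs_eq, Mem_eq, Com_eq, Und_eq}"
proof (intro conjI)
  note ax = axioms_equations
  have C: "models (three_valued (\<lambda>c. c)) {DNeg_eq, Neg_eq, Or_eq, Tand_eq, Abs_eq, Mem_eq, Com_eq, Und_eq}"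
    by (simp add: three_valued)
  show "completely_axiomatises {} {DNeg_eq, Or_eq, Abs_eq, Mem_eq, Com_eq} CL"
    by (rule completely_axiomatises_by_models)
      (use ax C in \<open>simp_all add: models_axioms_iff[symmetric]\<close>)
  show "completely_axiomatises {CT, CF} {Neg_eq, Or_eq, Tand_eq, Abs_eq, Mem_eq, Com_eq} CL2"
    by (rule completely_axiomatises_by_models)
      (use ax[of "{CT, CF}"] C in \<open>simp_all add: models_CL2_iff, simp_all add: CL2_def\<close>)
  show "completely_axiomatises {CU} {DNeg_eq, Und_eq, Or_eq, Abs_eq, Mem_eq, Com_eq} CLU"
    by (rule completely_axiomatises_by_models)
      (use ax[of "{CU}"] C in \<open>simp_all add: models_CLU_iff, simp_all add: CLU_def\<close>)
  show "completely_axiomatises {CT, CF, CU}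
       {Neg_eq, Or_eq, Tand_eq, Abs_eq, Mem_eq, Com_eq, Und_eq} CL3"
    by (rule completely_axiomatises_by_models)
      (use ax[of "{CT, CF, CU}"] C in \<open>simp_all add: models_CL3_iff, simp_all add: CL3_def\<close>)
qed (rule independent_with_DNeg_eq independent_with_Tand_eq; simp)+

end
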